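(* Let $A=(a_{ij})$ be an expansive $n\times n$ integer matrix which is strictly (row) diagonally dominant, i.e. $|a_{ii}|>\sum_{j\neq i}|a_{ij}|$ for every $i$, and whose associated directed graph is strongly connected. Then $A$ is strictly expansive.
   Context: An $n\times n$ integer matrix $A$ is expansive if all of its (complex) eigenvalues have modulus larger than $1$. An expansive integer matrix $A$ is strictly expansive if there exists a compact set $K\subset\mathbb{R}^n$ such that $\sum_{k\in\mathbb{Z}^n} I_K(x+k)=1$ for almost every $x\in\mathbb{R}^n$ (where $I_K$ is the indicator function of $K$) and $A(K^\circ)\supset K$, where $K^\circ$ is the interior of $K$. The directed graph $G=(V,E)$ associated with $A=(a_{ij})$ has vertex set $V=\{1,\dots,n\}$, and $(i,j)\in E$ if and only if $a_{ij}\neq 0$. *)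

theory Defs
  imports "HOL-Analysis.Analysis" "Graph_Theory.Pair_Digraph" "Graph_Theory.Digraph_Component"
begin

definition eigenvalue :: "complex ^ 'n ^ 'n \<Rightarrow> complex \<Rightarrow> bool" where
  "eigenvalue A c \<longleftrightarrow> (\<exists>v. v \<noteq> 0 \<and> A *v v = c *s v)"

definition expansive :: "int ^ 'n ^ 'n \<Rightarrow> bool" where
  "expansive A \<longleftrightarrow> (\<forall>c. eigenvalue (map_matrix of_int A) c \<longrightarrow> cmod c > 1)"

definition int_points :: "(real ^ 'n) set" where
  "int_points = {k. \<forall>i. k $ i \<in> \<int>}"

(* For compact K only finitely many summands are nonzero at each x, so the
   unordered sum below is a finite one. *)
definition tiles_by_translation :: "(real ^ 'n) set \<Rightarrow> bool" where
  "tiles_by_translation K \<longleftrightarrow>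
     (AE x in lebesgue. ((\<lambda>k. indicator K (x + k) :: real) has_sum 1) int_points)"

(* The inclusion is automatically proper: an expansive A is invertible, so the image of the
   interior is open, whereas a compact tiling set K is nonempty and hence not open. *)
definition strictly_expansive :: "int ^ 'n ^ 'n \<Rightarrow> bool" where
  "strictly_expansive A \<longleftrightarrow> expansive A \<and>
     (\<exists>K :: (real ^ 'n) set. compact K \<and> tiles_by_translation K \<and>
        K \<subseteq> (\<lambda>x. map_matrix of_int A *v x) ` interior K)"

definition strictly_diagonally_dominant :: "int ^ 'n ^ 'n \<Rightarrow> bool" where
  "strictly_diagonally_dominant A \<longleftrightarrow>
     (\<forall>i. \<bar>A $ i $ i\<bar> > (\<Sum>j \<in> UNIV - {i}. \<bar>A $ i $ j\<bar>))"

definition matrix_digraph :: "int ^ 'n ^ 'n \<Rightarrow> 'n pair_pre_digraph" where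
  "matrix_digraph A = \<lparr> pverts = UNIV, parcs = {(i, j). A $ i $ j \<noteq> 0} \<rparr>"

end

theory Submission
  imports Defs
begin

text \<open>
  Let M be the matrix A acting on real vectors and Q the unit cube centred at the origin. Integrality
  sharpens strict dominance to: in each row, the diagonal entry exceeds the off-diagonal absolute sum
  by at least 1. Hence M does not shrink the maximum norm, so the preimage of Q under M lies in Q.
  If it even lies in the interior of Q, then Q itself is the required set K. This may fail: for the
  matrix with rows (2, -1) and (1, -2), which is expansive, the corner (1/2, 1/2) is mapped to
  the corner (1/2, -1/2).

  Such contacts are very rigid. If M does not increase the maximum norm of x, the inequalities behind
  dominance are equalities in every row where the coordinate of x is extremal; they force extremality
  on all out-neighbours, and by strong connectivity on all coordinates (lemma extremal_vector). So a
  point x on the boundary of Q with M x in Q is a corner, and so is p = M x. Applying the same lemma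
  to the sum of two contact points shows that x and -x are the only ones (lemma contact_unique).
  Being expansive, A has neither 1 nor -1 as an eigenvalue, so p is neither x nor -x.

  This leaves room to repair Q. Corners of Q differ by integer vectors, so small pieces of Q
  at p and -p may be cut off and moved to x and -x without disturbing the tiling (lemma
  tiles_move_piece). The points whose preimages were on the boundary are now gone from Q, while the
  pieces added around x and -x are harmless: the preimages of x and -x lie in the interior
  of Q and away from p and -p, and this persists for nearby points by openness of M.
\<close>

section \<open>Tilings by integer translates\<close>

lemma int_points_add: "k \<in> int_points \<Longrightarrow> l \<in> int_points \<Longrightarrow> k + l \<in> int_points"
  by (simp add: int_points_def)

lemma int_points_diff: "k \<in> int_points \<Longrightarrow> l \<in> int_points \<Longrightarrow> k - l \<in> int_points"
  by (simp add: int_points_def)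

lemma int_points_uminus: "k \<in> int_points \<Longrightarrow> - k \<in> int_points"
  by (simp add: int_points_def)

lemma countable_int_points: "countable (int_points :: (real ^ 'n) set)"
proof -
  have "k \<in> range (\<lambda>f :: 'n \<Rightarrow> int. \<chi> i. of_int (f i))" if "k \<in> int_points" for k :: "real ^ 'n"
  proof
    show "k = (\<chi> i. of_int \<lfloor>k $ i\<rfloor>)"
      using that by (simp add: int_points_def vec_eq_iff)
  qed simp
  then show ?thesis
    by (metis countableI_type countable_image countable_subset subsetI)
qed

lemma AE_int_translates_avoid_negligible:
  fixes S :: "(real ^ 'n) set"
  assumes "negligible S"
  shows "AE x in lebesgue. \<forall>k\<in>int_points. x + k \<notin> S"
proof -
  have "negligible (\<Union>k\<in>int_points. (+) (- k) ` S)"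
  proof (rule negligible_countable_Union)
    show "countable ((\<lambda>k. (+) (- k) ` S) ` int_points)"
      by (intro countable_image countable_int_points)
    show "negligible T" if "T \<in> (\<lambda>k. (+) (- k) ` S) ` int_points" for T
      using that negligible_translation[OF assms] by blast
  qed
  moreover have "x \<in> (\<Union>k\<in>int_points. (+) (- k) ` S)" if "k \<in> int_points" "x + k \<in> S" for x k
    using that by (intro UN_I[of k] image_eqI[of _ _ "x + k"]) auto
  ultimately show ?thesis
    by (intro AE_I'[of "\<Union>k\<in>int_points. (+) (- k) ` S"]) (auto simp: negligible_iff_null_sets)
qed

text \<open>
  All terms of the sum are 0 or 1, so a total of 1 means that exactly one of them is 1. In this form the
  tiling condition can be checked pointwise, by following the one translate that covers a point.
\<close>

lemma indicator_has_sum_1_iff_ex1: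
  "((\<lambda>k. indicator K (f k) :: real) has_sum 1) Z \<longleftrightarrow> (\<exists>!k. k \<in> Z \<and> f k \<in> K)"
proof
  assume sum: "((\<lambda>k. indicator K (f k) :: real) has_sum 1) Z"
  have "\<exists>k\<in>Z. f k \<in> K"
  proof (rule ccontr)
    assume "\<not> (\<exists>k\<in>Z. f k \<in> K)"
    then have "((\<lambda>k. indicator K (f k) :: real) has_sum 0) Z"
      by (intro has_sum_0) auto
    with sum show False
      using has_sum_unique by fastforce
  qed
  moreover have "k = l" if "k \<in> Z" "f k \<in> K" "l \<in> Z" "f l \<in> K" for k l
  proof (rule ccontr)
    assume "k \<noteq> l"
    then have "((\<lambda>k. indicator K (f k) :: real) has_sum 2) {k, l}"
      using that by (intro has_sum_finiteI) auto
    then have "2 \<le> (1::real)"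
      by (rule has_sum_mono_neutral[OF _ sum]) (use that in auto)
    then show False by simp
  qed
  ultimately show "\<exists>!k. k \<in> Z \<and> f k \<in> K" by blast
next
  assume "\<exists>!k. k \<in> Z \<and> f k \<in> K"
  then obtain k where k: "k \<in> Z" "f k \<in> K" and uniq: "\<And>l. l \<in> Z \<Longrightarrow> f l \<in> K \<Longrightarrow> l = k"
    by blast
  have "((\<lambda>k. indicator K (f k) :: real) has_sum 1) {k}"
    using k by (intro has_sum_finiteI) auto
  moreover have "((\<lambda>k. indicator K (f k) :: real) has_sum 1) {k} \<longleftrightarrow>
      ((\<lambda>k. indicator K (f k) :: real) has_sum 1) Z"
  proof (rule has_sum_cong_neutral)
    fix l assume "l \<in> Z - {k}"
    then show "indicator K (f l) = (0 :: real)"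
      using uniq[of l] by (auto simp: indicator_def)
  qed (use k in auto)
  ultimately show "((\<lambda>k. indicator K (f k) :: real) has_sum 1) Z" by simp
qed

lemma tiles_by_translation_iff_ex1:
  "tiles_by_translation K \<longleftrightarrow> (AE x in lebesgue. \<exists>!k. k \<in> int_points \<and> x + k \<in> K)"
  by (simp add: tiles_by_translation_def indicator_has_sum_1_iff_ex1)

text \<open>
  The moved piece is cut along the closure of U and what remains along U itself, so both parts keep
  their boundary and compactness is preserved; the price is an overlap in the frontier of U.
\<close>

definition move_piece :: "(real ^ 'n) set \<Rightarrow> (real ^ 'n) set \<Rightarrow> real ^ 'n \<Rightarrow> (real ^ 'n) set" where
  "move_piece K U v = (K - U) \<union> (+) v ` (K \<inter> closure U)"

lemma compact_move_piece:
  assumes "compact K" "open U"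
  shows "compact (move_piece K U v)"
  unfolding move_piece_def using assms
  by (intro compact_Un compact_diff compact_translation compact_Int_closed closed_closure)

text \<open>
  If x + k is the unique translate of x in K, then the unique one in the modified set is x + k + v or
  x + k, according to whether or not x + k lies in U. This holds as soon as no integer translate of x
  hits the frontier of U, which excludes only a null set.
\<close>

lemma tiles_move_piece:
  fixes K :: "(real ^ 'n) set"
  assumes tiles: "tiles_by_translation K" and "open U" "negligible (frontier U)"
    and v: "v \<in> int_points"
  shows "tiles_by_translation (move_piece K U v)"
proof -
  from tiles have "AE x in lebesgue. \<exists>!k. k \<in> int_points \<and> x + k \<in> K"
    by (simp add: tiles_by_translation_iff_ex1)
  moreover have "AE x in lebesgue. \<forall>k\<in>int_points. x + k \<notin> frontier U"
    by (rule AE_int_translates_avoid_negligible) fact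
  ultimately show ?thesis
    unfolding tiles_by_translation_iff_ex1
  proof eventually_elim
    case (elim x)
    then obtain k where k: "k \<in> int_points" "x + k \<in> K"
      and uniq: "\<And>l. l \<in> int_points \<Longrightarrow> x + l \<in> K \<Longrightarrow> l = k"
      by blast
    have closure: "x + k \<in> closure U \<longleftrightarrow> x + k \<in> U"
      using elim(2) k(1) \<open>open U\<close> closure_subset[of U]
      by (auto simp: frontier_def interior_open)
    have moved: "x + l \<in> move_piece K U v \<longleftrightarrow>
        (if x + k \<in> U then l = k + v else l = k)" if l: "l \<in> int_points" for l
    proof -
      have "x + l \<in> (+) v ` (K \<inter> closure U) \<longleftrightarrow> x + (l - v) \<in> K \<inter> closure U"
        by (auto simp: image_iff algebra_simps intro!: bexI[of _ "x + (l - v)"])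
      also have "\<dots> \<longleftrightarrow> l - v = k \<and> x + k \<in> U"
        using uniq[of "l - v"] k closure int_points_diff[OF l v] by auto
      finally have "x + l \<in> (+) v ` (K \<inter> closure U) \<longleftrightarrow> l = k + v \<and> x + k \<in> U"
        by (auto simp: algebra_simps)
      moreover have "x + l \<in> K - U \<longleftrightarrow> l = k \<and> x + k \<notin> U"
        using uniq[of l] k l by auto
      ultimately show ?thesis
        by (auto simp: move_piece_def)
    qed
    then show ?case
      using k(1) int_points_add[OF k(1) v] by (cases "x + k \<in> U") auto
  qed
qed

section \<open>The unit cube\<close>

definition unit_cube :: "(real ^ 'n) set" where
  "unit_cube = {x. \<forall>i. \<bar>x $ i\<bar> \<le> 1 / 2}"

lemma unit_cube_eq_cbox: "unit_cube = cbox (\<chi> i. - 1 / 2) (\<chi> i. 1 / 2)"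
proof -
  have "\<bar>t\<bar> \<le> 1 / 2 \<longleftrightarrow> - 1 / 2 \<le> t \<and> t \<le> 1 / 2" for t :: real
    by linarith
  then show ?thesis
    by (simp add: unit_cube_def set_eq_iff mem_box_cart)
qed

lemma interior_unit_cube: "interior unit_cube = {x. \<forall>i. \<bar>x $ i\<bar> < 1 / 2}"
proof -
  have "\<bar>t\<bar> < 1 / 2 \<longleftrightarrow> - 1 / 2 < t \<and> t < 1 / 2" for t :: real
    by linarith
  then show ?thesis
    by (simp add: unit_cube_eq_cbox interior_cbox set_eq_iff mem_box_cart)
qed

lemma compact_unit_cube: "compact unit_cube"
  by (simp add: unit_cube_eq_cbox)

lemma tiles_unit_cube: "tiles_by_translation (unit_cube :: (real ^ 'n) set)"
proof -
  let ?Q = "unit_cube :: (real ^ 'n) set"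
  have "negligible (frontier ?Q)"
    by (intro negligible_convex_frontier) (simp add: unit_cube_eq_cbox)
  from AE_int_translates_avoid_negligible[OF this] show ?thesis
    unfolding tiles_by_translation_iff_ex1
  proof eventually_elim
    case (elim x)
    \<comment> \<open>x + k is x reduced modulo 1 to coordinates in the half-open interval from -1/2 to 1/2\<close>
    define k :: "real ^ 'n" where "k = (\<chi> i. - of_int \<lfloor>x $ i + 1 / 2\<rfloor>)"
    have k: "k \<in> int_points"
      by (simp add: k_def int_points_def)
    moreover have "x + k \<in> ?Q"
      unfolding unit_cube_def
    proof safe
      fix i
      have "\<bar>t - of_int \<lfloor>t + 1 / 2\<rfloor>\<bar> \<le> 1 / 2" for t :: real
        by linarith
      then show "\<bar>(x + k) $ i\<bar> \<le> 1 / 2"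
        by (simp add: k_def)
    qed
    moreover have "l = m" if lm: "l \<in> int_points" "x + l \<in> ?Q" "m \<in> int_points" "x + m \<in> ?Q" for l m
    proof -
      have interior: "x + l \<in> interior ?Q" "x + m \<in> interior ?Q"
        using elim lm closure_subset[of ?Q] by (auto simp: frontier_def)
      have "l $ i = m $ i" for i
      proof -
        have "\<bar>x $ i + l $ i\<bar> < 1 / 2" "\<bar>x $ i + m $ i\<bar> < 1 / 2"
          using interior by (auto simp: interior_unit_cube)
        then have "\<bar>l $ i - m $ i\<bar> < 1"
          by linarith
        then show ?thesis
          using lm(1,3) Ints_nonzero_abs_less1[of "l $ i - m $ i"] by (auto simp: int_points_def)
      qed
      then show ?thesis by (simp add: vec_eq_iff)
    qed
    ultimately show ?case by blast
  qed
qed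

section \<open>Diagonally dominant matrices and the unit cube\<close>

abbreviation real_matrix :: "int ^ 'n ^ 'n \<Rightarrow> real ^ 'n ^ 'n" where
  "real_matrix A \<equiv> map_matrix of_int A"

text \<open>
  A real eigenvector for the eigenvalue 1 or -1 is also a complex one, and these eigenvalues have
  modulus 1.
\<close>

lemma expansive_no_fixed_or_negated_vector:
  fixes x :: "real ^ 'n"
  assumes "expansive A" and "x \<noteq> 0"
  shows "real_matrix A *v x \<noteq> x" and "real_matrix A *v x \<noteq> - x"
proof -
  define z :: "complex ^ 'n" where "z = (\<chi> i. of_real (x $ i))"
  have z: "z \<noteq> 0"
    using \<open>x \<noteq> 0\<close> by (auto simp: z_def vec_eq_iff)
  have Az: "(map_matrix of_int A *v z) $ i = of_real ((real_matrix A *v x) $ i)" for i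
    by (simp add: matrix_vector_mult_def z_def)
  show "real_matrix A *v x \<noteq> x"
  proof
    assume "real_matrix A *v x = x"
    then have "map_matrix of_int A *v z = 1 *s z"
      by (simp add: vec_eq_iff Az) (simp add: z_def)
    with z assms(1) have "cmod 1 > 1"
      unfolding expansive_def eigenvalue_def by blast
    then show False by simp
  qed
  show "real_matrix A *v x \<noteq> - x"
  proof
    assume "real_matrix A *v x = - x"
    then have "map_matrix of_int A *v z = (-1) *s z"
      by (simp add: vec_eq_iff Az) (simp add: z_def)
    with z assms(1) have "cmod (-1) > 1"
      unfolding expansive_def eigenvalue_def by blast
    then show False by simp
  qed
qed

locale dominant_connected =
  fixes A :: "int ^ 'n ^ 'n"
  assumes dominant: "strictly_diagonally_dominant A"
    and connected: "strongly_connected (with_proj (matrix_digraph A))"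
begin

text \<open>
  One row of the dominance estimate. With a denoting the i-th row,
  m \<ge> |(A x)_i| \<ge> |a_i| m - (\<Sum>j\<noteq>i. |a_j| |x_j|) \<ge> m + (\<Sum>j\<noteq>i. |a_j| (m - |x_j|)) \<ge> m,
  where the third inequality uses that the diagonal excess, a positive integer, is at least 1.
  So every summand |a_j| (m - |x_j|) vanishes.
\<close>

lemma extremal_row:
  fixes x :: "real ^ 'n"
  assumes x: "\<And>j. \<bar>x $ j\<bar> \<le> m" and Ax: "\<And>j. \<bar>(real_matrix A *v x) $ j\<bar> \<le> m"
    and i: "\<bar>x $ i\<bar> = m"
  shows "\<bar>(real_matrix A *v x) $ i\<bar> = m" and "A $ i $ j \<noteq> 0 \<Longrightarrow> \<bar>x $ j\<bar> = m"
proof -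
  define a where "a j = real_of_int (A $ i $ j)" for j
  define R where "R = UNIV - {i}"
  have "(\<Sum>j\<in>R. \<bar>A $ i $ j\<bar>) + 1 \<le> \<bar>A $ i $ i\<bar>"
    using dominant by (auto simp: strictly_diagonally_dominant_def R_def add1_zle_eq)
  then have "real_of_int ((\<Sum>j\<in>R. \<bar>A $ i $ j\<bar>) + 1) \<le> real_of_int \<bar>A $ i $ i\<bar>"
    by (simp only: of_int_le_iff)
  then have dom: "(\<Sum>j\<in>R. \<bar>a j\<bar>) + 1 \<le> \<bar>a i\<bar>"
    by (simp add: a_def)
  have m: "m \<ge> 0" using i by auto
  have row: "(real_matrix A *v x) $ i = a i * x $ i + (\<Sum>j\<in>R. a j * x $ j)"
    by (simp add: matrix_vector_mult_def a_def R_def sum.remove[of UNIV i])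
  have "\<bar>\<Sum>j\<in>R. a j * x $ j\<bar> \<le> (\<Sum>j\<in>R. \<bar>a j\<bar> * \<bar>x $ j\<bar>)"
    by (metis (no_types, lifting) abs_mult sum_abs sum.cong)
  moreover have "\<bar>a i * x $ i\<bar> = \<bar>a i\<bar> * m"
    by (simp add: abs_mult i)
  ultimately have "\<bar>a i\<bar> * m - (\<Sum>j\<in>R. \<bar>a j\<bar> * \<bar>x $ j\<bar>) \<le> \<bar>(real_matrix A *v x) $ i\<bar>"
    unfolding row by linarith
  moreover have "((\<Sum>j\<in>R. \<bar>a j\<bar>) + 1) * m \<le> \<bar>a i\<bar> * m"
    using dom m by (rule mult_right_mono)
  moreover have "(\<Sum>j\<in>R. \<bar>a j\<bar> * (m - \<bar>x $ j\<bar>)) = (\<Sum>j\<in>R. \<bar>a j\<bar>) * m - (\<Sum>j\<in>R. \<bar>a j\<bar> * \<bar>x $ j\<bar>)"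
    by (simp add: right_diff_distrib sum_subtractf sum_distrib_right)
  ultimately have squeeze: "m + (\<Sum>j\<in>R. \<bar>a j\<bar> * (m - \<bar>x $ j\<bar>)) \<le> \<bar>(real_matrix A *v x) $ i\<bar>"
    by (simp add: algebra_simps)
  have nonneg: "\<bar>a j\<bar> * (m - \<bar>x $ j\<bar>) \<ge> 0" for j
    using x[of j] by simp
  then have sum_nonneg: "(\<Sum>j\<in>R. \<bar>a j\<bar> * (m - \<bar>x $ j\<bar>)) \<ge> 0"
    by (intro sum_nonneg)
  with squeeze Ax[of i] show "\<bar>(real_matrix A *v x) $ i\<bar> = m"
    by linarith
  from squeeze Ax[of i] sum_nonneg have "(\<Sum>j\<in>R. \<bar>a j\<bar> * (m - \<bar>x $ j\<bar>)) = 0"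
    by linarith
  then have "\<forall>j\<in>R. \<bar>a j\<bar> * (m - \<bar>x $ j\<bar>) = 0"
    using nonneg by (subst (asm) sum_nonneg_eq_0_iff) auto
  then show "\<bar>x $ j\<bar> = m" if "A $ i $ j \<noteq> 0"
    using that i by (cases "j = i") (auto simp: R_def a_def)
qed

text \<open>
  Extremality passes from a row to its out-neighbours, hence along all paths of the digraph.
\<close>

lemma extremal_vector:
  fixes x :: "real ^ 'n"
  assumes x: "\<And>j. \<bar>x $ j\<bar> \<le> m" and Ax: "\<And>j. \<bar>(real_matrix A *v x) $ j\<bar> \<le> m"
    and i: "\<bar>x $ i\<bar> = m"
  shows "\<bar>x $ j\<bar> = m" and "\<bar>(real_matrix A *v x) $ j\<bar> = m"
proof -
  have "i \<rightarrow>\<^sup>*\<^bsub>with_proj (matrix_digraph A)\<^esub> j"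
    using connected by (auto simp: strongly_connected_def matrix_digraph_def)
  then have "(i, j) \<in> {(k, l). A $ k $ l \<noteq> 0}\<^sup>*"
    by (auto dest: reachable_rtranclI simp: matrix_digraph_def)
  then show "\<bar>x $ j\<bar> = m"
  proof (induction rule: rtrancl_induct)
    case base
    show ?case by fact
  next
    case (step k l)
    then show ?case
      using extremal_row(2)[OF x Ax] by simp
  qed
  then show "\<bar>(real_matrix A *v x) $ j\<bar> = m"
    by (rule extremal_row(1)[OF x Ax])
qed

text \<open>
  Were the maximum norm m of x at least 1/2, the previous lemma with this m would give A x the
  maximum norm m too, which leaves only m = 1/2.
\<close>

lemma vector_in_cube_preimage:
  fixes x :: "real ^ 'n"
  assumes Ax: "real_matrix A *v x \<in> unit_cube"
  shows "x \<in> interior unit_cube \<or>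
    (\<forall>j. \<bar>x $ j\<bar> = 1 / 2) \<and> (\<forall>j. \<bar>(real_matrix A *v x) $ j\<bar> = 1 / 2)"
proof -
  define m where "m = Max (range (\<lambda>j. \<bar>x $ j\<bar>))"
  have le: "\<bar>x $ j\<bar> \<le> m" for j
    by (simp add: m_def)
  have "m \<in> range (\<lambda>j. \<bar>x $ j\<bar>)"
    unfolding m_def by (rule Max_in) auto
  then obtain i where i: "\<bar>x $ i\<bar> = m" by auto
  have Ax': "\<bar>(real_matrix A *v x) $ j\<bar> \<le> 1 / 2" for j
    using Ax by (simp add: unit_cube_def)
  show ?thesis
  proof (cases "m < 1 / 2")
    case True
    then have "\<forall>j. \<bar>x $ j\<bar> < 1 / 2"
      using le le_less_trans by blast
    then show ?thesis
      by (simp add: interior_unit_cube)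
  next
    case False
    then have *: "\<bar>(real_matrix A *v x) $ j\<bar> \<le> m" for j
      using Ax'[of j] by linarith
    note extremal = extremal_vector[OF le * i]
    have "m = 1 / 2"
      using extremal(2)[of i] Ax'[of i] False by linarith
    then show ?thesis
      using extremal by auto
  qed
qed

text \<open>
  Every multiple of a kernel vector lies in the preimage of the cube, so the kernel vector has to be
  bounded and thus zero.
\<close>

lemma bij_real_matrix: "bij ((*v) (real_matrix A))"
proof -
  have "x = 0" if 0: "real_matrix A *v x = 0" for x :: "real ^ 'n"
  proof (rule ccontr)
    assume "x \<noteq> 0"
    then obtain j where j: "x $ j \<noteq> 0"
      by (auto simp: vec_eq_iff)
    define t where "t = 1 / \<bar>x $ j\<bar>"
    have "real_matrix A *v (t *s x) = 0"
      using 0 by (simp add: vector_scalar_commute)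
    then have "t *s x \<in> interior unit_cube"
      using vector_in_cube_preimage[of "t *s x"] by (auto simp: unit_cube_def)
    then have "\<bar>(t *s x) $ j\<bar> < 1 / 2"
      unfolding interior_unit_cube by blast
    with j show False
      by (simp add: t_def abs_mult)
  qed
  then have "inj ((*v) (real_matrix A))"
    by (metis matrix_left_invertible_injective matrix_left_invertible_ker)
  then show ?thesis
    by (metis invertible_eq_bij invertible_left_inverse matrix_left_invertible_injective)
qed

text \<open>
  The sum of two contact points satisfies the bounds of the lemma extremal_vector with m = 1. If it is
  nonzero, then one of its coordinates is 1 or -1, hence all are, and the two corners agree everywhere.
\<close>

lemma contact_unique:
  fixes x y :: "real ^ 'n"
  assumes x: "\<And>j. \<bar>x $ j\<bar> = 1 / 2" "\<And>j. \<bar>(real_matrix A *v x) $ j\<bar> = 1 / 2"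
    and y: "\<And>j. \<bar>y $ j\<bar> = 1 / 2" "\<And>j. \<bar>(real_matrix A *v y) $ j\<bar> = 1 / 2"
  shows "y = x \<or> y = - x"
proof (rule disjCI)
  assume "y \<noteq> - x"
  then obtain i where i: "y $ i \<noteq> - (x $ i)"
    by (auto simp: vec_eq_iff)
  have bounds: "\<bar>(x + y) $ j\<bar> \<le> 1" "\<bar>(real_matrix A *v (x + y)) $ j\<bar> \<le> 1" for j
    using x(1)[of j] y(1)[of j] x(2)[of j] y(2)[of j]
    by (simp_all add: matrix_vector_right_distrib abs_le_iff, linarith+)
  have "\<bar>(x + y) $ i\<bar> = 1"
    using i x(1)[of i] y(1)[of i] by (simp add: abs_if split: if_splits)
  then have "\<bar>(x + y) $ j\<bar> = 1" for j
    by (rule extremal_vector(1)[OF bounds])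
  then have "\<bar>x $ j + y $ j\<bar> = 1" for j
    by (simp flip: vector_add_component)
  moreover have "b = a" if "\<bar>a\<bar> = 1 / 2" "\<bar>b\<bar> = 1 / 2" "\<bar>a + b\<bar> = 1" for a b :: real
    using that by linarith
  ultimately have "y $ j = x $ j" for j
    using x(1) y(1) by blast
  then show "y = x" by (simp add: vec_eq_iff)
qed

text \<open>
  The repair of the cube at a contact point x with image p. The open sets G e, which consist of the
  interior of Q without the balls of radius e around p and -p, serve as a supply of interior points of
  the repaired set K: it contains G e by construction, and the radius e is chosen so small that G e
  contains the preimage of K.
\<close>

lemma strictly_expansive_if_contact:
  fixes x :: "real ^ 'n"
  assumes exp: "expansive A"
    and x: "\<And>j. \<bar>x $ j\<bar> = 1 / 2" and Ax: "\<And>j. \<bar>(real_matrix A *v x) $ j\<bar> = 1 / 2"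
  shows "strictly_expansive A"
proof -
  let ?M = "(*v) (real_matrix A)"
  let ?Q = "unit_cube :: (real ^ 'n) set"
  define p where "p = ?M x"
  define v where "v = x - p"
  have lin: "linear ?M" by simp
  have neg: "?M (- y) = - ?M y" for y
    by (rule linear_neg[OF lin])
  have "x \<noteq> 0"
    using x by fastforce
  then have px: "p \<noteq> x" "p \<noteq> - x" "- p \<noteq> x"
    using expansive_no_fixed_or_negated_vector[OF exp, of x] by (auto simp: p_def minus_equation_iff)
  \<comment> \<open>translation by v takes the corner p to the corner x, and translation by -v takes -p to -x\<close>
  have v: "v \<in> int_points"
    unfolding int_points_def
  proof safe
    fix j
    have "v $ j \<in> {-1, 0, 1}"
      using x[of j] Ax[of j] by (auto simp: v_def p_def abs_if split: if_splits)
    then show "v $ j \<in> \<int>" by auto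
  qed
  have corner: "z \<notin> interior ?Q" if "z \<in> {x, - x, p, - p}" for z
    using that x Ax by (auto simp: p_def interior_unit_cube)
  have contact: "y \<in> interior ?Q \<or> y = x \<or> y = - x" if "?M y \<in> ?Q" for y
    using vector_in_cube_preimage[OF that] contact_unique[OF x Ax, of y] by blast
  define L where "L = ?M -` ?Q"
  have "closed L"
    unfolding L_def using compact_unit_cube
    by (intro closed_vimage compact_imp_closed) (auto intro: continuous_intros)
  have pL: "p \<notin> L" "- p \<notin> L"
    using contact[of p] contact[of "- p"] corner px by (auto simp: L_def)
  \<comment> \<open>the preimage of Q avoids the balls of radius e1 around p and -p, so cutting them out costs nothing\<close>
  obtain r s where r: "r > 0" "cball p r \<inter> L = {}" and s: "s > 0" "cball (- p) s \<inter> L = {}"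
    using pL \<open>closed L\<close> open_contains_cball[of "- L"] by (metis ComplI disjoint_eq_subset_Compl open_Compl)
  define e1 where "e1 = min r s"
  have e1: "e1 > 0" "cball p e1 \<inter> L = {}" "cball (- p) e1 \<inter> L = {}"
    using r s by (auto simp: e1_def)
  define G where "G e = interior ?Q - cball p e - cball (- p) e" for e
  have open_G: "open (G e)" for e
    by (simp add: G_def open_Diff)
  \<comment> \<open>x and -x are interior to the image of G e1, so small pieces may be added to Q around them\<close>
  have "open (?M ` G e1)"
    by (rule open_surjective_linear_image) (use open_G lin bij_real_matrix in \<open>auto simp: bij_is_surj\<close>)
  moreover have "z \<in> ?M ` G e1" if z: "z \<in> {x, - x}" for z
  proof -
    obtain y where y: "?M y = z"
      using bij_real_matrix by (metis bij_pointE)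
    have "z \<in> ?Q" using z x by (auto simp: unit_cube_def)
    then have "y \<in> L" using y by (simp add: L_def)
    moreover have "y \<noteq> x" "y \<noteq> - x"
      using y z px neg[of x] by (auto simp: p_def)
    then have "y \<in> interior ?Q"
      using contact[of y] \<open>z \<in> ?Q\<close> y by auto
    ultimately have "y \<in> G e1"
      using e1 by (auto simp: G_def)
    with y show ?thesis by blast
  qed
  ultimately obtain r s where r: "r > 0" "cball x r \<subseteq> ?M ` G e1" and s: "s > 0" "cball (- x) s \<subseteq> ?M ` G e1"
    by (metis insertCI open_contains_cball)
  define e where "e = min e1 (min r s)"
  have e: "e > 0" "e \<le> e1" "cball x e \<subseteq> ?M ` G e1" "cball (- x) e \<subseteq> ?M ` G e1"
    using r s e1 by (auto simp: e_def)
  have "G e1 \<subseteq> G e"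
    using \<open>e \<le> e1\<close> by (auto simp: G_def)
  define K where "K = move_piece (move_piece ?Q (ball p e) v) (ball (- p) e) (- v)"
  have "compact K"
    unfolding K_def by (intro compact_move_piece compact_unit_cube open_ball)
  moreover have "tiles_by_translation K"
    unfolding K_def
    by (intro tiles_move_piece tiles_unit_cube open_ball negligible_convex_frontier convex_ball
        v int_points_uminus)
  moreover have "K \<subseteq> ?M ` interior K"
  proof -
    have "G e \<subseteq> K"
      using interior_subset[of ?Q] by (auto simp: G_def K_def move_piece_def)
    then have "G e \<subseteq> interior K"
      using open_G by (rule interior_maximal)
    have moved: "(+) w ` (S \<inter> closure (ball q e)) \<subseteq> cball (w + q) e" for S and w q :: "real ^ 'n"
      using e(1) by (auto simp: dist_norm)
    have "K \<subseteq> (?Q - ball p e - ball (- p) e) \<union> cball (v + p) e \<union> cball (- v + - p) e"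
      using moved[of v ?Q p] moved[of "- v" _ "- p"] unfolding K_def move_piece_def by blast
    then have "K \<subseteq> (?Q - ball p e - ball (- p) e) \<union> cball x e \<union> cball (- x) e"
      by (simp add: v_def)
    moreover have "z \<in> ?M ` G e" if z: "z \<in> ?Q - ball p e - ball (- p) e" for z
    proof -
      obtain y where y: "?M y = z"
        using bij_real_matrix by (metis bij_pointE)
      \<comment> \<open>x and -x are mapped to p and -p, the centres of the balls cut out\<close>
      have "y \<noteq> x" "y \<noteq> - x"
        using y z e(1) neg[of x] by (auto simp: p_def)
      then have "y \<in> interior ?Q" "y \<in> L"
        using contact[of y] y z by (auto simp: L_def)
      then have "y \<in> G e1"
        using e1 by (auto simp: G_def)
      with y \<open>G e1 \<subseteq> G e\<close> show ?thesis by blast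
    qed
    ultimately have "K \<subseteq> ?M ` G e"
      using e(3,4) \<open>G e1 \<subseteq> G e\<close> by blast
    with \<open>G e \<subseteq> interior K\<close> show ?thesis by blast
  qed
  ultimately show ?thesis
    unfolding strictly_expansive_def using exp by blast
qed

end

theorem theorem2p8:
  fixes A :: "int ^ 'n ^ 'n"
  assumes "expansive A"
    and "strictly_diagonally_dominant A"
    and "strongly_connected (with_proj (matrix_digraph A))"
  shows "strictly_expansive A"
proof -
  interpret dominant_connected A
    using assms(2,3) by unfold_locales
  show ?thesis
  proof (cases "\<exists>x :: real ^ 'n. (\<forall>j. \<bar>x $ j\<bar> = 1 / 2) \<and> (\<forall>j. \<bar>(real_matrix A *v x) $ j\<bar> = 1 / 2)")
    case True
    then show ?thesis
      using strictly_expansive_if_contact[OF assms(1)] by blast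
  next
    case False
    have "unit_cube \<subseteq> (*v) (real_matrix A) ` interior unit_cube"
    proof
      fix z :: "real ^ 'n"
      assume "z \<in> unit_cube"
      moreover obtain y where "z = real_matrix A *v y"
        using bij_real_matrix by (metis bij_pointE)
      ultimately show "z \<in> (*v) (real_matrix A) ` interior unit_cube"
        using vector_in_cube_preimage[of y] False by blast
    qed
    then show ?thesis
      unfolding strictly_expansive_def
      using assms(1) compact_unit_cube tiles_unit_cube by blast
  qed
qed

end
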